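(* There exists a universal constant $C>0$ such that, for the adaptive response contamination model with sample size $n$, dimension $p$, contamination rate $\epsilon$ and noise level $\sigma>0$, $$\inf_{\widehat\beta}\ \sup_{\beta,Q}\ \mathbb{P}_{\beta,\sigma,Q}\left(\|\widehat\beta-\beta\|_2\ge C\sigma\left(\sqrt{\frac{p}{n}}+\frac{\epsilon}{\sqrt{\log(n\epsilon^2/p+e)}}\right)\right)\ge\frac12,$$ where the infimum is over all estimators $\widehat\beta$ based on $(X_1,y_1),\dots,(X_n,y_n)$, the supremum is over all $\beta\in\mathbb{R}^p$ and all contamination kernels $Q=\{Q_x\}_{x\in\mathbb{R}^p}$, and $\mathbb{P}_{\beta,\sigma,Q}$ is the data distribution of the model.
   Context: Adaptive response contamination model: $\epsilon\in[0,1/2)$, $p\in\mathbb{N}$; $(X_i,y_i)$, $i=1,\dots,n$, are i.i.d. with $X_i\sim\mathcal{N}(0,I_p)$ and $y_i\mid X_i\sim(1-\epsilon)\mathcal{N}(X_i^\top\beta,\sigma^2)+\epsilon Q_{X_i}$, where $Q_x$ is an arbitrary conditional distribution on $\mathbb{R}$ depending on $x$. Logarithms are natural. *)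

theory Defs
  imports "HOL-Probability.Probability"
begin

text \<open>
  The dimension and the sample size vary inside the statement, so vectors of length \<open>p\<close> are
  extensional functions on \<open>{..<p}\<close>, and a data set of size \<open>n\<close> is an extensional function
  from \<open>{..<n}\<close> to pairs of a covariate vector and a response.
\<close>

abbreviation vec_space :: "nat \<Rightarrow> (nat \<Rightarrow> real) measure" where
  "vec_space p \<equiv> PiM {..<p} (\<lambda>_. borel)"

abbreviation obs_space :: "nat \<Rightarrow> ((nat \<Rightarrow> real) \<times> real) measure" where
  "obs_space p \<equiv> vec_space p \<Otimes>\<^sub>M borel"

abbreviation data_space :: "nat \<Rightarrow> nat \<Rightarrow> (nat \<Rightarrow> (nat \<Rightarrow> real) \<times> real) measure" where
  "data_space n p \<equiv> PiM {..<n} (\<lambda>_. obs_space p)"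

definition gaussian :: "real \<Rightarrow> real \<Rightarrow> real measure" where
  "gaussian \<mu> \<sigma> = density lborel (normal_density \<mu> \<sigma>)"

definition gaussian_vec :: "nat \<Rightarrow> (nat \<Rightarrow> real) measure" where
  "gaussian_vec p = PiM {..<p} (\<lambda>_. gaussian 0 1)"

definition mixture :: "real \<Rightarrow> 'a measure \<Rightarrow> 'a measure \<Rightarrow> 'a measure" where
  "mixture \<epsilon> P Q = measure_of (space P) (sets P)
     (\<lambda>A. ennreal (1 - \<epsilon>) * emeasure P A + ennreal \<epsilon> * emeasure Q A)"

definition response_law ::
  "nat \<Rightarrow> real \<Rightarrow> real \<Rightarrow> (nat \<Rightarrow> real) \<Rightarrow> ((nat \<Rightarrow> real) \<Rightarrow> real measure) \<Rightarrow> (nat \<Rightarrow> real) \<Rightarrow> real measure"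
where
  "response_law p \<epsilon> \<sigma> \<beta> Q x = mixture \<epsilon> (gaussian (\<Sum>j<p. x j * \<beta> j) \<sigma>) (Q x)"

definition obs_law ::
  "nat \<Rightarrow> real \<Rightarrow> real \<Rightarrow> (nat \<Rightarrow> real) \<Rightarrow> ((nat \<Rightarrow> real) \<Rightarrow> real measure) \<Rightarrow> ((nat \<Rightarrow> real) \<times> real) measure"
where
  "obs_law p \<epsilon> \<sigma> \<beta> Q =
     gaussian_vec p \<bind> (\<lambda>x. response_law p \<epsilon> \<sigma> \<beta> Q x \<bind> (\<lambda>y. return (obs_space p) (x, y)))"

definition data_law ::
  "nat \<Rightarrow> nat \<Rightarrow> real \<Rightarrow> real \<Rightarrow> (nat \<Rightarrow> real) \<Rightarrow> ((nat \<Rightarrow> real) \<Rightarrow> real measure) \<Rightarrow>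
   (nat \<Rightarrow> (nat \<Rightarrow> real) \<times> real) measure"
where
  "data_law n p \<epsilon> \<sigma> \<beta> Q = PiM {..<n} (\<lambda>_. obs_law p \<epsilon> \<sigma> \<beta> Q)"

text \<open>An arbitrary conditional distribution is a Markov kernel: \<open>Q x\<close> is a Borel probability
  measure on the reals for every \<open>x\<close>, depending measurably on \<open>x\<close>.\<close>

definition contaminations :: "nat \<Rightarrow> ((nat \<Rightarrow> real) \<Rightarrow> real measure) set" where
  "contaminations p = vec_space p \<rightarrow>\<^sub>M prob_algebra borel"

definition estimators :: "nat \<Rightarrow> nat \<Rightarrow> ((nat \<Rightarrow> (nat \<Rightarrow> real) \<times> real) \<Rightarrow> nat \<Rightarrow> real) set" where
  "estimators n p = data_space n p \<rightarrow>\<^sub>M vec_space p"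

lemma space_gaussian [simp]: "space (gaussian \<mu> \<sigma>) = UNIV"
  and sets_gaussian [simp, measurable_cong]: "sets (gaussian \<mu> \<sigma>) = sets borel"
  by (simp_all add: gaussian_def)

lemma prob_space_gaussian: "0 < \<sigma> \<Longrightarrow> prob_space (gaussian \<mu> \<sigma>)"
  unfolding gaussian_def by (rule prob_space_normal_density)

lemma sets_gaussian_vec [simp, measurable_cong]: "sets (gaussian_vec p) = sets (vec_space p)"
  unfolding gaussian_vec_def by (intro sets_PiM_cong) auto

lemma prob_space_gaussian_vec: "prob_space (gaussian_vec p)"
  unfolding gaussian_vec_def by (intro prob_space_PiM prob_space_gaussian) simp

lemma space_mixture [simp]: "space (mixture \<epsilon> P Q) = space P"
  and sets_mixture [simp, measurable_cong]: "sets (mixture \<epsilon> P Q) = sets P"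
  by (simp_all add: mixture_def)

lemma emeasure_mixture:
  assumes "sets Q = sets P" "A \<in> sets P"
  shows "emeasure (mixture \<epsilon> P Q) A = ennreal (1 - \<epsilon>) * emeasure P A + ennreal \<epsilon> * emeasure Q A"
proof (rule emeasure_measure_of[OF mixture_def])
  show "countably_additive (sets (mixture \<epsilon> P Q))
          (\<lambda>A. ennreal (1 - \<epsilon>) * emeasure P A + ennreal \<epsilon> * emeasure Q A)"
    unfolding countably_additive_def
  proof (intro allI impI)
    fix F :: "nat \<Rightarrow> _" assume F: "range F \<subseteq> sets (mixture \<epsilon> P Q)" "disjoint_family F"
    have "(\<Sum>i. ennreal (1 - \<epsilon>) * emeasure P (F i) + ennreal \<epsilon> * emeasure Q (F i)) =
      ennreal (1 - \<epsilon>) * (\<Sum>i. emeasure P (F i)) + ennreal \<epsilon> * (\<Sum>i. emeasure Q (F i))"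
      by (subst suminf_add[symmetric]) (auto intro!: summableI)
    also have "\<dots> = ennreal (1 - \<epsilon>) * emeasure P (\<Union>i. F i) + ennreal \<epsilon> * emeasure Q (\<Union>i. F i)"
      using F assms by (simp add: suminf_emeasure)
    finally show "(\<Sum>i. ennreal (1 - \<epsilon>) * emeasure P (F i) + ennreal \<epsilon> * emeasure Q (F i)) =
      ennreal (1 - \<epsilon>) * emeasure P (\<Union>i. F i) + ennreal \<epsilon> * emeasure Q (\<Union>i. F i)" .
  qed
qed (use assms sets.space_closed in \<open>auto simp: positive_def\<close>)

lemma prob_space_mixture:
  assumes "prob_space P" "prob_space Q" "sets Q = sets P" "0 \<le> \<epsilon>" "\<epsilon> \<le> 1"
  shows "prob_space (mixture \<epsilon> P Q)"
proof
  have "emeasure Q (space P) = 1"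
    using prob_space.emeasure_space_1[OF assms(2)] sets_eq_imp_space_eq[OF assms(3)] by simp
  then show "emeasure (mixture \<epsilon> P Q) (space (mixture \<epsilon> P Q)) = 1"
    using assms by (simp add: emeasure_mixture prob_space.emeasure_space_1 flip: ennreal_plus)
qed

lemma measurable_gaussian [measurable]:
  assumes "0 < \<sigma>"
  shows "(\<lambda>\<mu>. gaussian \<mu> \<sigma>) \<in> borel \<rightarrow>\<^sub>M prob_algebra borel"
proof (rule measurable_prob_algebraI)
  show "(\<lambda>\<mu>. gaussian \<mu> \<sigma>) \<in> borel \<rightarrow>\<^sub>M subprob_algebra borel"
  proof (rule measurable_subprob_algebra)
    fix A :: "real set" assume [measurable]: "A \<in> sets borel"
    have "(\<lambda>\<mu>. \<integral>\<^sup>+ x. ennreal (normal_density \<mu> \<sigma> x) * indicator A x \<partial>lborel) \<in> borel_measurable borel"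
      unfolding normal_density_def by measurable
    then show "(\<lambda>\<mu>. emeasure (gaussian \<mu> \<sigma>) A) \<in> borel_measurable borel"
      by (simp add: gaussian_def emeasure_density)
  qed (use assms in \<open>auto intro: prob_space_imp_subprob_space prob_space_gaussian\<close>)
qed (use assms in \<open>auto intro: prob_space_gaussian\<close>)

lemma contaminationsD:
  assumes "Q \<in> contaminations p" "x \<in> space (vec_space p)"
  shows "prob_space (Q x)" "sets (Q x) = sets borel"
  using measurable_space[OF assms(1)[unfolded contaminations_def] assms(2)]
  by (auto simp: space_prob_algebra)

lemma measurable_response_law:
  assumes Q: "Q \<in> contaminations p" and "0 \<le> \<epsilon>" "\<epsilon> \<le> 1" "0 < \<sigma>"
  shows "response_law p \<epsilon> \<sigma> \<beta> Q \<in> vec_space p \<rightarrow>\<^sub>M prob_algebra borel"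
proof (rule measurable_prob_algebraI)
  have ps: "prob_space (response_law p \<epsilon> \<sigma> \<beta> Q x)" if "x \<in> space (vec_space p)" for x
    unfolding response_law_def using contaminationsD[OF Q that] assms
    by (intro prob_space_mixture prob_space_gaussian) auto
  then show "\<And>x. x \<in> space (vec_space p) \<Longrightarrow> prob_space (response_law p \<epsilon> \<sigma> \<beta> Q x)" .
  show "response_law p \<epsilon> \<sigma> \<beta> Q \<in> vec_space p \<rightarrow>\<^sub>M subprob_algebra borel"
  proof (rule measurable_subprob_algebra)
    fix A :: "real set" assume A [measurable]: "A \<in> sets borel"
    have [measurable]: "Q \<in> vec_space p \<rightarrow>\<^sub>M subprob_algebra borel"
      using Q unfolding contaminations_def by (rule measurable_prob_algebraD)
    have [measurable]: "(\<lambda>\<mu>. gaussian \<mu> \<sigma>) \<in> borel \<rightarrow>\<^sub>M subprob_algebra borel"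
      using measurable_gaussian[OF \<open>0 < \<sigma>\<close>] by (rule measurable_prob_algebraD)
    have "(\<lambda>x. ennreal (1 - \<epsilon>) * emeasure (gaussian (\<Sum>j<p. x j * \<beta> j) \<sigma>) A + ennreal \<epsilon> * emeasure (Q x) A)
            \<in> borel_measurable (vec_space p)"
      by measurable
    then show "(\<lambda>x. emeasure (response_law p \<epsilon> \<sigma> \<beta> Q x) A) \<in> borel_measurable (vec_space p)"
      by (rule measurable_cong[THEN iffD1, rotated])
         (simp add: response_law_def emeasure_mixture contaminationsD[OF Q] A)
  qed (use ps in \<open>auto simp: response_law_def intro: prob_space_imp_subprob_space\<close>)
qed

lemma obs_law_in_prob_algebra:
  assumes "Q \<in> contaminations p" "0 \<le> \<epsilon>" "\<epsilon> \<le> 1" "0 < \<sigma>"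
  shows "obs_law p \<epsilon> \<sigma> \<beta> Q \<in> space (prob_algebra (obs_space p))"
proof -
  have [measurable]: "response_law p \<epsilon> \<sigma> \<beta> Q \<in> vec_space p \<rightarrow>\<^sub>M prob_algebra borel"
    by (rule measurable_response_law[OF assms])
  have K: "(\<lambda>x. response_law p \<epsilon> \<sigma> \<beta> Q x \<bind> (\<lambda>y. return (obs_space p) (x, y)))
      \<in> vec_space p \<rightarrow>\<^sub>M prob_algebra (obs_space p)"
    by (rule measurable_bind_prob_space2[where N = borel]) measurable
  have "(\<lambda>_. gaussian_vec p) \<in> count_space (UNIV :: unit set) \<rightarrow>\<^sub>M prob_algebra (vec_space p)"
    by (rule measurable_const) (simp add: space_prob_algebra prob_space_gaussian_vec)
  from measurable_space[OF measurable_bind_prob_space[OF this K]] show ?thesis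
    unfolding obs_law_def by simp
qed

lemma
  assumes "Q \<in> contaminations p" "0 \<le> \<epsilon>" "\<epsilon> \<le> 1" "0 < \<sigma>"
  shows prob_space_data_law: "prob_space (data_law n p \<epsilon> \<sigma> \<beta> Q)"
    and sets_data_law: "sets (data_law n p \<epsilon> \<sigma> \<beta> Q) = sets (data_space n p)"
  using obs_law_in_prob_algebra[OF assms] unfolding data_law_def
  by (auto simp: space_prob_algebra intro!: prob_space_PiM sets_PiM_cong)

end

theory Submission
  imports Defs
begin

text \<open>
  With \<open>\<delta> = \<epsilon>/2\<close> and \<open>\<tau>\<^sup>2 = \<sigma>\<^sup>2/(1 - \<delta>)\<close>, the density of \<open>N(w, \<tau>\<^sup>2)\<close> dominates \<open>1 - \<epsilon>\<close> times that of
  \<open>N(u, \<sigma>\<^sup>2)\<close> whenever \<open>\<bar>u - w\<bar> \<le> \<delta>\<sigma>\<close>. The adversary can therefore turn the response law given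
  \<open>x\<close> into \<open>N(w, \<tau>\<^sup>2)\<close>, where \<open>w/\<sigma>\<close> is the soft thresholding at \<open>\<delta>\<close> of \<open>x \<bullet> \<theta>\<close> and
  \<open>\<beta> = \<sigma>\<theta>\<close>. Only samples with \<open>\<bar>x \<bullet> \<theta>\<bar> > \<delta>\<close> then carry information about \<open>\<theta>\<close>; for \<open>\<parallel>\<theta>\<parallel> \<le> R\<close>
  with \<open>R\<close> of the order of the rate, the expectation of the sum of \<open>(w/\<sigma>)\<^sup>2\<close> over the sample is at
  most \<open>8p\<close>. On the event that this sum is at most \<open>64p\<close> the likelihood ratio against
  \<open>N(0, \<tau>\<^sup>2)\<close> responses has second moment at most \<open>exp(64p)\<close>. A fine grid of \<open>m\<^sup>p\<close> parameters
  \<open>\<theta>\<close> beats this factor: under the reference law any estimator is close to only \<open>(2e)\<^sup>p\<close> of them,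
  so it fails with probability at least one half at some grid point.
\<close>

lemma PiM_density:
  fixes f :: "'a \<Rightarrow> ennreal"
  assumes I: "finite I" and M: "prob_space M" and f [measurable]: "f \<in> borel_measurable M"
    and D: "prob_space (density M f)"
  shows "PiM I (\<lambda>_. density M f) = density (PiM I (\<lambda>_. M)) (\<lambda>\<omega>. \<Prod>i\<in>I. f (\<omega> i))"
proof -
  interpret D: prob_space "density M f" by (rule D)
  interpret M: prob_space M by (rule M)
  interpret PD: product_sigma_finite "\<lambda>_. density M f"
    by standard
  interpret PM: product_sigma_finite "\<lambda>_. M"
    by standard
  show ?thesis
  proof (rule PD.PiM_eqI[OF I, symmetric])
    show "sets (density (PiM I (\<lambda>_. M)) (\<lambda>\<omega>. \<Prod>i\<in>I. f (\<omega> i))) = sets (PiM I (\<lambda>_. density M f))"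
      by (simp, intro sets_PiM_cong) auto
    fix A :: "_ \<Rightarrow> 'a set" assume "\<And>i. i \<in> I \<Longrightarrow> A i \<in> sets (density M f)"
    then have A [measurable]: "A i \<in> sets M" if "i \<in> I" for i
      using that by simp
    have "emeasure (density (PiM I (\<lambda>_. M)) (\<lambda>\<omega>. \<Prod>i\<in>I. f (\<omega> i))) (PiE I A) =
        (\<integral>\<^sup>+\<omega>. (\<Prod>i\<in>I. f (\<omega> i)) * indicator (PiE I A) \<omega> \<partial>PiM I (\<lambda>_. M))"
      using I by (intro emeasure_density) (auto intro!: sets_PiM_I_finite A)
    also have "\<dots> = (\<integral>\<^sup>+\<omega>. (\<Prod>i\<in>I. f (\<omega> i) * indicator (A i) (\<omega> i)) \<partial>PiM I (\<lambda>_. M))"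
    proof (intro nn_integral_cong)
      fix \<omega> assume \<omega>: "\<omega> \<in> space (PiM I (\<lambda>_. M))"
      have "indicator (PiE I A) \<omega> = (\<Prod>i\<in>I. indicator (A i) (\<omega> i) :: ennreal)"
        using I \<omega> by (auto simp: space_PiM PiE_iff indicator_def prod_zero_iff)
      then show "(\<Prod>i\<in>I. f (\<omega> i)) * indicator (PiE I A) \<omega> = (\<Prod>i\<in>I. f (\<omega> i) * indicator (A i) (\<omega> i))"
        by (simp add: prod.distrib)
    qed
    also have "\<dots> = (\<Prod>i\<in>I. \<integral>\<^sup>+x. f x * indicator (A i) x \<partial>M)"
      by (rule PM.product_nn_integral_prod[OF I]) measurable
    also have "\<dots> = (\<Prod>i\<in>I. emeasure (density M f) (A i))"
      by (intro prod.cong refl emeasure_density[symmetric]) auto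
    finally show "emeasure (density (PiM I (\<lambda>_. M)) (\<lambda>\<omega>. \<Prod>i\<in>I. f (\<omega> i))) (PiE I A) =
      (\<Prod>i\<in>I. emeasure (density M f) (A i))" .
  qed
qed

lemma emeasure_PiM_density_le:
  fixes L v :: "'a \<Rightarrow> real" and c :: real
  assumes I: "finite I" and M: "prob_space M" and D: "prob_space (density M L)"
    and L [measurable]: "L \<in> borel_measurable M" and L0: "\<And>x. 0 \<le> L x"
    and v [measurable]: "v \<in> borel_measurable M" and v0: "\<And>x. 0 \<le> v x"
    and second: "(\<integral>\<^sup>+x. ennreal ((L x)\<^sup>2 * exp (- v x)) \<partial>M) \<le> 1"
    and first: "(\<integral>\<^sup>+x. ennreal (v x) \<partial>density M L) \<le> ennreal c" and c: "0 \<le> c"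
    and A [measurable]: "A \<in> sets (PiM I (\<lambda>_. M))" and K: "0 < K" and S: "0 < S"
  shows "emeasure (PiM I (\<lambda>_. density M L)) A \<le>
    ennreal (card I * c / K) + ennreal (exp K / S) + ennreal S * emeasure (PiM I (\<lambda>_. M)) A"
proof -
  define P where "P = PiM I (\<lambda>_. density M L)"
  define P0 where "P0 = PiM I (\<lambda>_. M)"
  define V where "V = (\<lambda>\<omega>. \<Sum>i\<in>I. v (\<omega> i))"
  interpret M: prob_space M by (rule M)
  interpret PM: product_sigma_finite "\<lambda>_. M"
    by standard
  interpret P0: prob_space P0
    unfolding P0_def by (intro prob_space_PiM M)
  have P_eq: "P = density P0 (\<lambda>\<omega>. \<Prod>i\<in>I. ennreal (L (\<omega> i)))"
    unfolding P_def P0_def by (rule PiM_density[OF I M _ D]) measurable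
  have sP [measurable_cong]: "sets P = sets (PiM I (\<lambda>_. M))" "sets P0 = sets (PiM I (\<lambda>_. M))"
    by (simp_all add: P_eq P0_def)
  have spP: "space P = space P0" "space P0 = space (PiM I (\<lambda>_. M))"
    by (simp_all add: P_eq P0_def)
  have V [measurable]: "V \<in> borel_measurable (PiM I (\<lambda>_. M))"
    unfolding V_def by measurable
  have V0: "0 \<le> V \<omega>" for \<omega>
    unfolding V_def by (intro sum_nonneg v0)
  have "(\<integral>\<^sup>+\<omega>. ennreal (V \<omega>) \<partial>P) = (\<Sum>i\<in>I. \<integral>\<^sup>+\<omega>. ennreal (v (\<omega> i)) \<partial>P)"
    unfolding V_def by (simp add: v0 nn_integral_sum P_def flip: sum_ennreal)
  also have "\<dots> = (\<Sum>i\<in>I. \<integral>\<^sup>+x. ennreal (v x) \<partial>density M L)"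
  proof (rule sum.cong[OF refl])
    fix i assume i: "i \<in> I"
    have "(\<integral>\<^sup>+x. ennreal (v x) \<partial>density M L) = (\<integral>\<^sup>+x. ennreal (v x) \<partial>distr P (density M L) (\<lambda>\<omega>. \<omega> i))"
      unfolding P_def using i D by (subst distr_PiM_component) auto
    also have "\<dots> = (\<integral>\<^sup>+\<omega>. ennreal (v (\<omega> i)) \<partial>P)"
      using i by (intro nn_integral_distr) (auto simp: P_def)
    finally show "(\<integral>\<^sup>+\<omega>. ennreal (v (\<omega> i)) \<partial>P) = (\<integral>\<^sup>+x. ennreal (v x) \<partial>density M L)" ..
  qed
  also have "\<dots> \<le> (\<Sum>i\<in>I. ennreal c)"
    by (intro sum_mono first)
  also have "\<dots> = ennreal (card I * c)"
    using c by (simp add: ennreal_mult ennreal_of_nat_eq_real_of_nat)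
  finally have EV: "(\<integral>\<^sup>+\<omega>. ennreal (V \<omega>) \<partial>P) \<le> ennreal (card I * c)" .
  have "emeasure P {\<omega>\<in>space P. 1 \<le> ennreal (1 / K) * ennreal (V \<omega>)} \<le>
      ennreal (1 / K) * (\<integral>\<^sup>+\<omega>. ennreal (V \<omega>) * indicator (space P) \<omega> \<partial>P)"
    by (intro nn_integral_Markov_inequality) auto
  also have "\<dots> \<le> ennreal (1 / K) * ennreal (card I * c)"
    by (intro mult_left_mono order_trans[OF _ EV]) (auto intro!: nn_integral_mono simp: indicator_def)
  also have "\<dots> = ennreal (card I * c / K)"
    using K c by (subst ennreal_mult[symmetric]) auto
  finally have large: "emeasure P {\<omega>\<in>space P. 1 \<le> ennreal (1 / K) * ennreal (V \<omega>)} \<le> ennreal (card I * c / K)" .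
  define B where "B = {\<omega>\<in>space P0. \<omega> \<in> A \<and> V \<omega> < K}"
  have B [measurable]: "B \<in> sets (PiM I (\<lambda>_. M))"
    unfolding B_def spP by measurable
  have "emeasure P B = (\<integral>\<^sup>+\<omega>. (\<Prod>i\<in>I. ennreal (L (\<omega> i))) * indicator B \<omega> \<partial>P0)"
    unfolding P_eq by (intro emeasure_density) auto
  also have "\<dots> \<le> (\<integral>\<^sup>+\<omega>. ennreal (exp K / S) * (\<Prod>i\<in>I. ennreal ((L (\<omega> i))\<^sup>2 * exp (- v (\<omega> i)))) +
      ennreal S * indicator A \<omega> \<partial>P0)"
  proof (intro nn_integral_mono)
    fix \<omega> assume "\<omega> \<in> space P0"
    define l where "l = (\<Prod>i\<in>I. L (\<omega> i))"
    define q where "q = (\<Prod>i\<in>I. (L (\<omega> i))\<^sup>2 * exp (- v (\<omega> i)))"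
    have l0: "0 \<le> l" and q0: "0 \<le> q"
      unfolding l_def q_def by (intro prod_nonneg; simp add: L0)+
    have l_eq: "l\<^sup>2 = q * exp (V \<omega>)"
      using I by (simp add: l_def q_def V_def exp_sum exp_minus mult.assoc flip: prod.distrib prod_power_distrib)
    have "l \<le> exp K / S * q + S" if "V \<omega> < K"
    proof (cases "l \<le> S")
      case False
      then have "S * l \<le> l\<^sup>2"
        using l0 by (auto simp: power2_eq_square intro: mult_right_mono)
      also have "\<dots> \<le> q * exp K"
        unfolding l_eq using q0 that by (intro mult_left_mono) auto
      finally have "l \<le> exp K / S * q"
        using S by (simp add: field_simps)
      then show ?thesis using S by simp
    qed (use q0 S in \<open>simp add: add_increasing\<close>)
    then have "ennreal l * indicator B \<omega> \<le> ennreal (exp K / S * q) + ennreal S * indicator A \<omega>"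
      using S q0 by (auto simp: indicator_def B_def simp flip: ennreal_plus intro!: ennreal_leI)
    also have "ennreal (exp K / S * q) = ennreal (exp K / S) * ennreal q"
      using q0 S by (intro ennreal_mult) auto
    finally show "(\<Prod>i\<in>I. ennreal (L (\<omega> i))) * indicator B \<omega> \<le>
        ennreal (exp K / S) * (\<Prod>i\<in>I. ennreal ((L (\<omega> i))\<^sup>2 * exp (- v (\<omega> i)))) + ennreal S * indicator A \<omega>"
      by (simp add: l_def q_def L0 prod_ennreal)
  qed
  also have "\<dots> = ennreal (exp K / S) * (\<integral>\<^sup>+\<omega>. (\<Prod>i\<in>I. ennreal ((L (\<omega> i))\<^sup>2 * exp (- v (\<omega> i)))) \<partial>P0) +
      ennreal S * emeasure P0 A"
    by (simp add: nn_integral_add nn_integral_cmult sP(2) A)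
  also have "(\<integral>\<^sup>+\<omega>. (\<Prod>i\<in>I. ennreal ((L (\<omega> i))\<^sup>2 * exp (- v (\<omega> i)))) \<partial>P0) =
      (\<Prod>i\<in>I. \<integral>\<^sup>+x. ennreal ((L x)\<^sup>2 * exp (- v x)) \<partial>M)"
    unfolding P0_def by (rule PM.product_nn_integral_prod[OF I]) measurable
  also have "ennreal (exp K / S) * \<dots> \<le> ennreal (exp K / S) * 1"
    using second by (intro mult_left_mono prod_le_1) auto
  finally have small: "emeasure P B \<le> ennreal (exp K / S) + ennreal S * emeasure P0 A"
    by (simp add: add_right_mono)
  have "emeasure P A \<le> emeasure P ({\<omega>\<in>space P. 1 \<le> ennreal (1 / K) * ennreal (V \<omega>)} \<union> B)"
  proof (rule emeasure_mono)
    show "A \<subseteq> {\<omega>\<in>space P. 1 \<le> ennreal (1 / K) * ennreal (V \<omega>)} \<union> B"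
    proof
      fix \<omega> assume "\<omega> \<in> A"
      moreover from this have "\<omega> \<in> space P0"
        using sets.sets_into_space[OF A] by (auto simp: spP)
      moreover have "1 \<le> ennreal (1 / K) * ennreal (V \<omega>)" if "\<not> V \<omega> < K"
        using that K V0 by (subst ennreal_mult[symmetric]) auto
      ultimately show "\<omega> \<in> {\<omega>\<in>space P. 1 \<le> ennreal (1 / K) * ennreal (V \<omega>)} \<union> B"
        by (auto simp: B_def spP)
    qed
  qed measurable
  also have "\<dots> \<le> emeasure P {\<omega>\<in>space P. 1 \<le> ennreal (1 / K) * ennreal (V \<omega>)} + emeasure P B"
    by (intro emeasure_subadditive) measurable
  also have "\<dots> \<le> ennreal (card I * c / K) + (ennreal (exp K / S) + ennreal S * emeasure P0 A)"
    by (intro add_mono large small)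
  finally show ?thesis
    by (simp add: P_def P0_def add.assoc)
qed

lemma normal_density_shift:
  assumes "0 < \<tau>"
  shows "normal_density w \<tau> y = normal_density 0 \<tau> y * exp ((w * y - w\<^sup>2 / 2) / \<tau>\<^sup>2)"
  using assms by (simp add: normal_density_def mult.assoc flip: exp_add)
    (simp add: field_simps power2_eq_square)

lemma gaussian_shift:
  assumes "0 < \<tau>"
  shows "gaussian w \<tau> = density (gaussian 0 \<tau>) (\<lambda>y. ennreal (exp ((w * y - w\<^sup>2 / 2) / \<tau>\<^sup>2)))"
  unfolding gaussian_def using assms
  by (subst density_density_eq) (auto simp: normal_density_shift[of \<tau> w] ennreal_mult' intro!: arg_cong2[where f=density])

lemma nn_integral_gaussian_shift:
  assumes "0 < \<tau>"
  shows "(\<integral>\<^sup>+y. ennreal (exp ((w * y - w\<^sup>2 / 2) / \<tau>\<^sup>2)) \<partial>gaussian 0 \<tau>) = 1"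
proof -
  have "1 = emeasure (gaussian w \<tau>) (space (gaussian w \<tau>))"
    using prob_space.emeasure_space_1[OF prob_space_gaussian[OF assms]] by simp
  also have "\<dots> = (\<integral>\<^sup>+y. ennreal (exp ((w * y - w\<^sup>2 / 2) / \<tau>\<^sup>2)) \<partial>gaussian 0 \<tau>)"
    by (subst gaussian_shift[OF assms]) (simp add: emeasure_density)
  finally show ?thesis ..
qed

lemma gaussian_vec_mgf:
  "(\<integral>\<^sup>+x. ennreal (exp (\<Sum>j<p. c j * x j)) \<partial>gaussian_vec p) = ennreal (exp ((\<Sum>j<p. (c j)\<^sup>2) / 2))"
proof -
  interpret prob_space "gaussian 0 1" by (simp add: prob_space_gaussian)
  interpret product_sigma_finite "\<lambda>_::nat. gaussian 0 1" by standard
  have "(\<integral>\<^sup>+x. ennreal (exp (\<Sum>j<p. c j * x j)) \<partial>gaussian_vec p) =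
      (\<integral>\<^sup>+x. (\<Prod>j<p. ennreal (exp (c j * x j))) \<partial>gaussian_vec p)"
    by (simp add: exp_sum prod_ennreal)
  also have "\<dots> = (\<Prod>j<p. \<integral>\<^sup>+y. ennreal (exp (c j * y)) \<partial>gaussian 0 1)"
    unfolding gaussian_vec_def by (rule product_nn_integral_prod) auto
  also have "\<dots> = (\<Prod>j<p. ennreal (exp ((c j)\<^sup>2 / 2)))"
  proof (rule prod.cong[OF refl])
    fix j
    have "(\<integral>\<^sup>+y. ennreal (exp (c j * y)) \<partial>gaussian 0 1) =
        (\<integral>\<^sup>+y. ennreal (exp ((c j)\<^sup>2 / 2)) * ennreal (exp ((c j * y - (c j)\<^sup>2 / 2) / 1\<^sup>2)) \<partial>gaussian 0 1)"
      by (simp flip: ennreal_mult exp_add)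
    also have "\<dots> = ennreal (exp ((c j)\<^sup>2 / 2))"
      by (subst nn_integral_cmult) (auto simp: nn_integral_gaussian_shift[of 1, simplified])
    finally show "(\<integral>\<^sup>+y. ennreal (exp (c j * y)) \<partial>gaussian 0 1) = ennreal (exp ((c j)\<^sup>2 / 2))" .
  qed
  also have "\<dots> = ennreal (exp ((\<Sum>j<p. (c j)\<^sup>2) / 2))"
    by (simp add: prod_ennreal sum_divide_distrib exp_sum)
  finally show ?thesis .
qed

definition soft :: "real \<Rightarrow> real \<Rightarrow> real" where
  "soft \<delta> u = sgn u * max 0 (\<bar>u\<bar> - \<delta>)"

lemma measurable_soft [measurable]: "soft \<delta> \<in> borel_measurable borel"
  unfolding soft_def[abs_def] by measurable

lemma soft_dist_le: "0 \<le> \<delta> \<Longrightarrow> \<bar>u - soft \<delta> u\<bar> \<le> \<delta>"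
  by (auto simp: soft_def sgn_if max_def)

lemma soft_square_le:
  assumes "0 < l"
  shows "(soft \<delta> u)\<^sup>2 \<le> 2 / l\<^sup>2 * exp (- l * \<delta>) * (exp (l * u) + exp (- l * u))"
proof -
  define t where "t = max 0 (\<bar>u\<bar> - \<delta>)"
  have t0: "0 \<le> t" by (simp add: t_def)
  have "(soft \<delta> u)\<^sup>2 \<le> t\<^sup>2"
    by (auto simp: soft_def power_mult_distrib sgn_if t_def)
  also have "t\<^sup>2 \<le> 2 / l\<^sup>2 * exp (l * (\<bar>u\<bar> - \<delta>))"
  proof (cases "\<bar>u\<bar> \<le> \<delta>")
    case False
    have "(l * t)\<^sup>2 / 2 \<le> exp (l * t)"
      using exp_lower_Taylor_quadratic[of "l * t"] assms t0 mult_nonneg_nonneg[of l t] by linarith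
    then have "t\<^sup>2 \<le> 2 / l\<^sup>2 * exp (l * t)"
      using assms by (simp add: field_simps power_mult_distrib)
    then show ?thesis
      using False by (simp add: t_def)
  qed (simp add: t_def)
  also have "exp (l * (\<bar>u\<bar> - \<delta>)) = exp (- l * \<delta>) * exp (l * \<bar>u\<bar>)"
    by (simp add: algebra_simps flip: exp_add)
  also have "2 / l\<^sup>2 * (exp (- l * \<delta>) * exp (l * \<bar>u\<bar>)) \<le>
      2 / l\<^sup>2 * (exp (- l * \<delta>) * (exp (l * u) + exp (- l * u)))"
    by (intro mult_left_mono) (auto simp: abs_if)
  finally show ?thesis by (simp only: mult.assoc)
qed

lemma gaussian_vec_soft_square_le:
  assumes "0 < l" "(\<Sum>j<p. (\<theta> j)\<^sup>2) \<le> R\<^sup>2"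
  shows "(\<integral>\<^sup>+x. ennreal ((soft \<delta> (\<Sum>j<p. x j * \<theta> j))\<^sup>2) \<partial>gaussian_vec p) \<le>
    ennreal (4 / l\<^sup>2 * exp (l\<^sup>2 * R\<^sup>2 / 2 - l * \<delta>))"
proof -
  have mgf: "(\<integral>\<^sup>+x. ennreal (exp (k * (\<Sum>j<p. x j * \<theta> j))) \<partial>gaussian_vec p) \<le> ennreal (exp (l\<^sup>2 * R\<^sup>2 / 2))"
    if "k\<^sup>2 = l\<^sup>2" for k
  proof -
    have "(\<integral>\<^sup>+x. ennreal (exp (k * (\<Sum>j<p. x j * \<theta> j))) \<partial>gaussian_vec p) =
        ennreal (exp (l\<^sup>2 * (\<Sum>j<p. (\<theta> j)\<^sup>2) / 2))"
      using gaussian_vec_mgf[of p "\<lambda>j. k * \<theta> j"] that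
      by (simp add: sum_distrib_left power_mult_distrib mult_ac)
    also have "\<dots> \<le> ennreal (exp (l\<^sup>2 * R\<^sup>2 / 2))"
      using assms by (intro ennreal_leI) (simp add: mult_left_mono)
    finally show ?thesis .
  qed
  have "(\<integral>\<^sup>+x. ennreal ((soft \<delta> (\<Sum>j<p. x j * \<theta> j))\<^sup>2) \<partial>gaussian_vec p) \<le>
      (\<integral>\<^sup>+x. ennreal (2 / l\<^sup>2 * exp (- l * \<delta>)) * (ennreal (exp (l * (\<Sum>j<p. x j * \<theta> j))) +
        ennreal (exp (- l * (\<Sum>j<p. x j * \<theta> j)))) \<partial>gaussian_vec p)"
    using soft_square_le[OF assms(1), of \<delta>]
    by (intro nn_integral_mono) (simp flip: ennreal_mult ennreal_plus)
  also have "\<dots> = ennreal (2 / l\<^sup>2 * exp (- l * \<delta>)) * ((\<integral>\<^sup>+x. ennreal (exp (l * (\<Sum>j<p. x j * \<theta> j))) \<partial>gaussian_vec p) +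
        (\<integral>\<^sup>+x. ennreal (exp (- l * (\<Sum>j<p. x j * \<theta> j))) \<partial>gaussian_vec p))"
    by (subst nn_integral_cmult; (subst nn_integral_add)?) auto
  also have "\<dots> \<le> ennreal (2 / l\<^sup>2 * exp (- l * \<delta>)) * (ennreal (exp (l\<^sup>2 * R\<^sup>2 / 2)) + ennreal (exp (l\<^sup>2 * R\<^sup>2 / 2)))"
    by (intro mult_left_mono add_mono mgf) auto
  also have "\<dots> = ennreal (4 / l\<^sup>2 * exp (l\<^sup>2 * R\<^sup>2 / 2 - l * \<delta>))"
    by (simp add: mult_exp_exp flip: ennreal_mult ennreal_plus)
  finally show ?thesis .
qed

lemma sum_exp_square_dist_le:
  fixes b :: real
  assumes "0 \<le> l"
  shows "(\<Sum>k<m. exp (- l * (b - real k)\<^sup>2)) \<le> 1 + real m * exp (- l / 4)"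
proof -
  define N where "N = {k\<in>{..<m}. \<bar>b - real k\<bar> < 1 / 2}"
  have "card N \<le> 1"
  proof (subst card_le_Suc0_iff_eq[unfolded One_nat_def[symmetric]])
    show "finite N" by (simp add: N_def)
    show "\<forall>a1\<in>N. \<forall>a2\<in>N. a1 = a2"
    proof (intro ballI)
      fix i j assume "i \<in> N" "j \<in> N"
      then have "\<bar>real i - real j\<bar> < 1"
        using abs_triangle_ineq4[of "b - real j" "b - real i"] unfolding N_def by simp
      then show "i = j" by linarith
    qed
  qed
  have "(\<Sum>k<m. exp (- l * (b - real k)\<^sup>2)) \<le> (\<Sum>k<m. indicator N k + exp (- l / 4))"
  proof (intro sum_mono)
    fix k assume k: "k \<in> {..<m}"
    show "exp (- l * (b - real k)\<^sup>2) \<le> indicator N k + exp (- l / 4)"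
    proof (cases "k \<in> N")
      case True
      then show ?thesis using assms by (simp add: add_increasing2)
    next
      case False
      then have "(1 / 2)\<^sup>2 \<le> (b - real k)\<^sup>2"
        using k by (intro abs_le_square_iff[THEN iffD1]) (auto simp: N_def)
      then have "l * (1 / 4) \<le> l * (b - real k)\<^sup>2"
        using assms by (intro mult_left_mono) (auto simp: power2_eq_square)
      then show ?thesis using False by simp
    qed
  qed
  also have "\<dots> = real (card N) + real m * exp (- l / 4)"
  proof -
    have "{..<m} \<inter> N = N" by (auto simp: N_def)
    then show ?thesis by (simp add: sum.distrib indicator_def sum.If_cases)
  qed
  finally show ?thesis using \<open>card N \<le> 1\<close> by linarith
qed

lemma card_grid_ball_le:
  fixes b :: "nat \<Rightarrow> real"
  assumes m: "0 < m"
  shows "real (card {k \<in> PiE {..<p} (\<lambda>_. {..<m}). 4 * real m * (\<Sum>j<p. (b j - real (k j))\<^sup>2) < real p})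
    \<le> (2 * exp 1) ^ p"
proof -
  let ?G = "PiE {..<p} (\<lambda>_. {..<m})" and ?l = "4 * real m"
  have fin: "finite ?G" by (intro finite_PiE) auto
  have "real (card {k \<in> ?G. ?l * (\<Sum>j<p. (b j - real (k j))\<^sup>2) < real p}) =
      (\<Sum>k\<in>?G. if ?l * (\<Sum>j<p. (b j - real (k j))\<^sup>2) < real p then 1 else 0)"
    using fin by (simp add: sum.If_cases Int_def)
  also have "\<dots> \<le> (\<Sum>k\<in>?G. exp (real p) * (\<Prod>j<p. exp (- ?l * (b j - real (k j))\<^sup>2)))"
    by (intro sum_mono) (auto simp: sum_distrib_left sum_negf simp flip: exp_sum exp_add)
  also have "\<dots> = exp (real p) * (\<Prod>j<p. \<Sum>k<m. exp (- ?l * (b j - real k)\<^sup>2))"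
    by (simp add: prod_sum_PiE flip: sum_distrib_left)
  also have "\<dots> \<le> exp (real p) * (\<Prod>j<p. 2)"
  proof (intro mult_left_mono prod_mono conjI)
    fix j
    have "(\<Sum>k<m. exp (- ?l * (b j - real k)\<^sup>2)) \<le> 1 + real m * exp (- ?l / 4)"
      by (rule sum_exp_square_dist_le) simp
    also have "real m * exp (- ?l / 4) \<le> 1"
      using exp_ge_add_one_self[of "real m"] by (simp add: exp_minus divide_simps del: exp_ge_add_one_self)
    finally show "(\<Sum>k<m. exp (- ?l * (b j - real k)\<^sup>2)) \<le> 2" by simp
  qed (auto intro: sum_nonneg)
  also have "\<dots> = (2 * exp 1) ^ p"
    by (simp add: power_mult_distrib flip: exp_of_nat_mult)
  finally show ?thesis .
qed

lemma normal_density_dominated: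
  assumes "0 < \<sigma>" "0 \<le> \<delta>" "\<delta> < 1 / 4" "\<bar>u - w\<bar> \<le> \<delta> * \<sigma>"
  shows "(1 - 2 * \<delta>) * normal_density u \<sigma> y \<le> normal_density w (\<sigma> / sqrt (1 - \<delta>)) y"
proof -
  define z where "z = (y - w) / \<sigma>"
  define d where "d = (u - w) / \<sigma>"
  have d: "\<bar>d\<bar> \<le> \<delta>"
    using assms by (simp add: d_def field_simps)
  have "2 * (z * d) \<le> 2 * (\<bar>z\<bar> * \<bar>d\<bar>)"
    using abs_ge_self[of "z * d"] by (simp add: abs_mult)
  also have "\<dots> \<le> 2 * (\<bar>z\<bar> * \<delta>)"
    using d by (intro mult_left_mono) auto
  also have "\<dots> \<le> \<delta> * (1 + z\<^sup>2)"
  proof -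
    have "0 \<le> \<delta> * (\<bar>z\<bar> - 1)\<^sup>2"
      using assms by simp
    then show ?thesis
      by (simp add: power2_diff algebra_simps)
  qed
  finally have zd: "2 * (z * d) \<le> \<delta> * (1 + z\<^sup>2)" .
  have expo: "- (z - d)\<^sup>2 / 2 \<le> \<delta> / 2 - (1 - \<delta>) * z\<^sup>2 / 2"
  proof -
    have "- (z - d)\<^sup>2 / 2 + (1 - \<delta>) * z\<^sup>2 / 2 = (2 * (z * d) - d\<^sup>2 - \<delta> * z\<^sup>2) / 2"
      by (simp add: power2_diff algebra_simps) (simp add: field_simps)
    also have "\<dots> \<le> \<delta> / 2"
    proof -
      have "2 * (z * d) \<le> \<delta> + \<delta> * z\<^sup>2"
        using zd by (simp add: distrib_left)
      then have "2 * (z * d) - \<delta> * z\<^sup>2 \<le> \<delta>"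
        by simp
      then have "2 * (z * d) - \<delta> * z\<^sup>2 - d\<^sup>2 \<le> \<delta>"
        by (rule order_trans[rotated]) simp
      then show ?thesis
        by (intro divide_right_mono) (simp_all add: algebra_simps)
    qed
    finally show ?thesis by simp
  qed
  have "(1 - 2 * \<delta>) * exp (\<delta> / 2) \<le> sqrt (1 - \<delta>)"
  proof (rule real_le_rsqrt)
    have "exp \<delta> * (1 - \<delta>) \<le> 1"
      using exp_ge_add_one_self[of "- \<delta>"] by (simp add: exp_minus field_simps)
    then have e: "exp \<delta> \<le> 1 / (1 - \<delta>)"
      using assms by (simp add: field_simps)
    have "((1 - 2 * \<delta>) * exp (\<delta> / 2))\<^sup>2 = (1 - 2 * \<delta>)\<^sup>2 * exp \<delta>"
      by (simp add: power_mult_distrib flip: exp_double)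
    also have "\<dots> \<le> (1 - \<delta>)\<^sup>2 * (1 / (1 - \<delta>))"
      using assms e by (intro mult_mono power_mono) auto
    also have "\<dots> = 1 - \<delta>"
      using assms by (simp add: power2_eq_square)
    finally show "((1 - 2 * \<delta>) * exp (\<delta> / 2))\<^sup>2 \<le> 1 - \<delta>" .
  qed
  then have *: "(1 - 2 * \<delta>) * exp (- (z - d)\<^sup>2 / 2) \<le> sqrt (1 - \<delta>) * exp (- (1 - \<delta>) * z\<^sup>2 / 2)"
  proof -
    have "(1 - 2 * \<delta>) * exp (- (z - d)\<^sup>2 / 2) \<le> (1 - 2 * \<delta>) * exp (\<delta> / 2 - (1 - \<delta>) * z\<^sup>2 / 2)"
      using assms expo by (intro mult_left_mono) auto
    also have "\<dots> = ((1 - 2 * \<delta>) * exp (\<delta> / 2)) * exp (- (1 - \<delta>) * z\<^sup>2 / 2)"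
      by (simp add: mult.assoc mult_exp_exp) (simp add: algebra_simps)
    also assume "(1 - 2 * \<delta>) * exp (\<delta> / 2) \<le> sqrt (1 - \<delta>)"
    finally show ?thesis by (simp add: mult_right_mono)
  qed
  have zdu: "z - d = (y - u) / \<sigma>"
    by (simp add: z_def d_def diff_divide_distrib)
  have "(1 - 2 * \<delta>) * normal_density u \<sigma> y = 1 / (\<sigma> * sqrt (2 * pi)) * ((1 - 2 * \<delta>) * exp (- (z - d)\<^sup>2 / 2))"
    using assms by (simp add: normal_density_def real_sqrt_mult zdu power_divide mult_ac)
  also have "\<dots> \<le> 1 / (\<sigma> * sqrt (2 * pi)) * (sqrt (1 - \<delta>) * exp (- (1 - \<delta>) * z\<^sup>2 / 2))"
    using assms * by (intro mult_left_mono) auto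
  also have "\<dots> = normal_density w (\<sigma> / sqrt (1 - \<delta>)) y"
    using assms by (simp add: normal_density_def real_sqrt_mult real_sqrt_divide power_divide z_def field_simps)
  finally show ?thesis .
qed

definition shrunk_mean :: "nat \<Rightarrow> real \<Rightarrow> real \<Rightarrow> (nat \<Rightarrow> real) \<Rightarrow> (nat \<Rightarrow> real) \<Rightarrow> real" where
  "shrunk_mean p \<epsilon> \<sigma> \<theta> x = \<sigma> * soft (\<epsilon> / 2) (\<Sum>j<p. x j * \<theta> j)"

text \<open>For \<open>\<epsilon> = 0\<close> the quotient below would be \<open>0\<close>, which is not a probability density.\<close>
definition masking_density :: "nat \<Rightarrow> real \<Rightarrow> real \<Rightarrow> (nat \<Rightarrow> real) \<Rightarrow> (nat \<Rightarrow> real) \<Rightarrow> real \<Rightarrow> real" where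
  "masking_density p \<epsilon> \<sigma> \<theta> x y =
    (let f = normal_density (shrunk_mean p \<epsilon> \<sigma> \<theta> x) (\<sigma> / sqrt (1 - \<epsilon> / 2)) y
     in if \<epsilon> = 0 then f else (f - (1 - \<epsilon>) * normal_density (\<sigma> * (\<Sum>j<p. x j * \<theta> j)) \<sigma> y) / \<epsilon>)"

definition masking :: "nat \<Rightarrow> real \<Rightarrow> real \<Rightarrow> (nat \<Rightarrow> real) \<Rightarrow> (nat \<Rightarrow> real) \<Rightarrow> real measure" where
  "masking p \<epsilon> \<sigma> \<theta> x = density lborel (masking_density p \<epsilon> \<sigma> \<theta> x)"

lemma measurable_shrunk_mean [measurable]: "shrunk_mean p \<epsilon> \<sigma> \<theta> \<in> borel_measurable (vec_space p)"
  unfolding shrunk_mean_def[abs_def] by measurable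

lemma measurable_masking_density [measurable]:
  "case_prod (masking_density p \<epsilon> \<sigma> \<theta>) \<in> borel_measurable (vec_space p \<Otimes>\<^sub>M borel)"
  "masking_density p \<epsilon> \<sigma> \<theta> x \<in> borel_measurable borel"
  unfolding masking_density_def normal_density_def Let_def by measurable

lemma masking_density_nonneg:
  assumes "0 \<le> \<epsilon>" "\<epsilon> < 1 / 2" "0 < \<sigma>"
  shows "0 \<le> masking_density p \<epsilon> \<sigma> \<theta> x y"
proof -
  let ?u = "\<sigma> * (\<Sum>j<p. x j * \<theta> j)" and ?w = "shrunk_mean p \<epsilon> \<sigma> \<theta> x"
  have "?u - ?w = \<sigma> * ((\<Sum>j<p. x j * \<theta> j) - soft (\<epsilon> / 2) (\<Sum>j<p. x j * \<theta> j))"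
    by (simp add: shrunk_mean_def algebra_simps)
  then have "\<bar>?u - ?w\<bar> \<le> \<epsilon> / 2 * \<sigma>"
    using assms soft_dist_le[of "\<epsilon> / 2" "\<Sum>j<p. x j * \<theta> j"]
    by (simp only:) (simp add: abs_mult mult.commute[of _ \<sigma>])
  then show ?thesis
    using assms normal_density_dominated[of \<sigma> "\<epsilon> / 2" ?u ?w y]
    by (auto simp: masking_density_def Let_def)
qed

lemma masking_prob_space:
  assumes "0 \<le> \<epsilon>" "\<epsilon> < 1 / 2" "0 < \<sigma>"
  shows "prob_space (masking p \<epsilon> \<sigma> \<theta> x)"
proof
  have \<tau>: "0 < \<sigma> / sqrt (1 - \<epsilon> / 2)"
    using assms by simp
  have I: "integrable lborel (masking_density p \<epsilon> \<sigma> \<theta> x)"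
    using assms \<tau> by (cases "\<epsilon> = 0") (auto simp: masking_density_def[abs_def] Let_def)
  have "(\<integral>y. masking_density p \<epsilon> \<sigma> \<theta> x y \<partial>lborel) = 1"
    using assms \<tau> by (cases "\<epsilon> = 0") (auto simp: masking_density_def[abs_def] Let_def)
  then show "emeasure (masking p \<epsilon> \<sigma> \<theta> x) (space (masking p \<epsilon> \<sigma> \<theta> x)) = 1"
    using I masking_density_nonneg[OF assms]
    by (simp add: masking_def emeasure_density nn_integral_eq_integral)
qed

lemma masking_contaminations:
  assumes "0 \<le> \<epsilon>" "\<epsilon> < 1 / 2" "0 < \<sigma>"
  shows "masking p \<epsilon> \<sigma> \<theta> \<in> contaminations p"
  unfolding contaminations_def
proof (rule measurable_prob_algebraI)
  show "masking p \<epsilon> \<sigma> \<theta> \<in> vec_space p \<rightarrow>\<^sub>M subprob_algebra borel"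
  proof (rule measurable_subprob_algebra)
    fix A :: "real set" assume [measurable]: "A \<in> sets borel"
    have "(\<lambda>x. \<integral>\<^sup>+ y. ennreal (masking_density p \<epsilon> \<sigma> \<theta> x y) * indicator A y \<partial>lborel) \<in> borel_measurable (vec_space p)"
      by measurable
    then show "(\<lambda>x. emeasure (masking p \<epsilon> \<sigma> \<theta> x) A) \<in> borel_measurable (vec_space p)"
      by (simp add: masking_def emeasure_density)
  qed (auto simp: masking_def[abs_def] intro: prob_space_imp_subprob_space masking_prob_space[OF assms, unfolded masking_def])
qed (rule masking_prob_space[OF assms])

lemma response_law_masking:
  assumes "0 \<le> \<epsilon>" "\<epsilon> < 1 / 2" "0 < \<sigma>"
  shows "response_law p \<epsilon> \<sigma> (\<lambda>j\<in>{..<p}. \<sigma> * \<theta> j) (masking p \<epsilon> \<sigma> \<theta>) x =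
    gaussian (shrunk_mean p \<epsilon> \<sigma> \<theta> x) (\<sigma> / sqrt (1 - \<epsilon> / 2))"
proof -
  let ?u = "\<sigma> * (\<Sum>j<p. x j * \<theta> j)" and ?w = "shrunk_mean p \<epsilon> \<sigma> \<theta> x" and ?\<tau> = "\<sigma> / sqrt (1 - \<epsilon> / 2)"
  have u: "(\<Sum>j<p. x j * (\<lambda>j\<in>{..<p}. \<sigma> * \<theta> j) j) = ?u"
    by (simp add: sum_distrib_left mult_ac)
  have "mixture \<epsilon> (gaussian ?u \<sigma>) (masking p \<epsilon> \<sigma> \<theta> x) = gaussian ?w ?\<tau>"
  proof (rule measure_eqI)
    fix A assume "A \<in> sets (mixture \<epsilon> (gaussian ?u \<sigma>) (masking p \<epsilon> \<sigma> \<theta> x))"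
    then have [measurable]: "A \<in> sets borel" by simp
    have "emeasure (mixture \<epsilon> (gaussian ?u \<sigma>) (masking p \<epsilon> \<sigma> \<theta> x)) A =
       ennreal (1 - \<epsilon>) * (\<integral>\<^sup>+y. ennreal (normal_density ?u \<sigma> y) * indicator A y \<partial>lborel) +
       ennreal \<epsilon> * (\<integral>\<^sup>+y. ennreal (masking_density p \<epsilon> \<sigma> \<theta> x y) * indicator A y \<partial>lborel)"
      by (subst emeasure_mixture) (auto simp: masking_def gaussian_def emeasure_density)
    also have "\<dots> = (\<integral>\<^sup>+y. ennreal (1 - \<epsilon>) * (ennreal (normal_density ?u \<sigma> y) * indicator A y) +
       ennreal \<epsilon> * (ennreal (masking_density p \<epsilon> \<sigma> \<theta> x y) * indicator A y) \<partial>lborel)"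
      by (subst nn_integral_add) (auto simp: nn_integral_cmult)
    also have "\<dots> = (\<integral>\<^sup>+y. ennreal (normal_density ?w ?\<tau> y) * indicator A y \<partial>lborel)"
    proof (intro nn_integral_cong)
      fix y
      have "(1 - \<epsilon>) * normal_density ?u \<sigma> y + \<epsilon> * masking_density p \<epsilon> \<sigma> \<theta> x y = normal_density ?w ?\<tau> y"
        if "\<epsilon> \<noteq> 0" using that by (simp add: masking_density_def Let_def)
      moreover have "normal_density ?u \<sigma> y = normal_density ?w ?\<tau> y" if "\<epsilon> = 0"
        using that by (simp add: shrunk_mean_def soft_def sgn_if)
      ultimately have "(1 - \<epsilon>) * normal_density ?u \<sigma> y + \<epsilon> * masking_density p \<epsilon> \<sigma> \<theta> x y = normal_density ?w ?\<tau> y"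
        by (cases "\<epsilon> = 0") simp_all
      then show "ennreal (1 - \<epsilon>) * (ennreal (normal_density ?u \<sigma> y) * indicator A y) +
          ennreal \<epsilon> * (ennreal (masking_density p \<epsilon> \<sigma> \<theta> x y) * indicator A y) =
          ennreal (normal_density ?w ?\<tau> y) * indicator A y"
        using assms masking_density_nonneg[OF assms]
        by (cases "y \<in> A") (simp_all flip: ennreal_mult ennreal_plus)
    qed
    also have "\<dots> = emeasure (gaussian ?w ?\<tau>) A"
      by (simp add: gaussian_def emeasure_density)
    finally show "emeasure (mixture \<epsilon> (gaussian ?u \<sigma>) (masking p \<epsilon> \<sigma> \<theta> x)) A = emeasure (gaussian ?w ?\<tau>) A" .
  qed simp
  then show ?thesis
    unfolding response_law_def u .
qed

lemma gaussian_regression_density: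
  assumes \<tau>: "0 < \<tau>" and w [measurable]: "w \<in> borel_measurable (vec_space p)"
  shows "gaussian_vec p \<bind> (\<lambda>x. gaussian (w x) \<tau> \<bind> (\<lambda>y. return (obs_space p) (x, y))) =
    density (gaussian_vec p \<Otimes>\<^sub>M gaussian 0 \<tau>) (\<lambda>z. ennreal (exp ((w (fst z) * snd z - (w (fst z))\<^sup>2 / 2) / \<tau>\<^sup>2)))"
    (is "?B = ?D")
proof -
  interpret G: prob_space "gaussian 0 \<tau>" by (rule prob_space_gaussian[OF \<tau>])
  have G [measurable]: "(\<lambda>x. gaussian (w x) \<tau>) \<in> vec_space p \<rightarrow>\<^sub>M prob_algebra borel"
    using measurable_compose[OF w measurable_gaussian[OF \<tau>]] .
  have K: "(\<lambda>x. gaussian (w x) \<tau> \<bind> (\<lambda>y. return (obs_space p) (x, y)))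
      \<in> vec_space p \<rightarrow>\<^sub>M prob_algebra (obs_space p)"
    by (rule measurable_bind_prob_space2[where N = borel]) measurable
  have gv: "gaussian_vec p \<in> space (prob_algebra (vec_space p))"
    by (simp add: space_prob_algebra prob_space_gaussian_vec)
  have K': "(\<lambda>x. gaussian (w x) \<tau> \<bind> (\<lambda>y. return (obs_space p) (x, y)))
      \<in> gaussian_vec p \<rightarrow>\<^sub>M subprob_algebra (obs_space p)"
    using measurable_prob_algebraD[OF K] by (simp cong: measurable_cong_sets)
  have ne: "space (gaussian_vec p) \<noteq> {}"
    using prob_space.not_empty[OF prob_space_gaussian_vec] .
  show ?thesis
  proof (rule measure_eqI)
    have sB: "sets ?B = sets (obs_space p)"
      by (rule sets_bind_measurable[OF K' ne])
    have sD: "sets (gaussian_vec p \<Otimes>\<^sub>M gaussian 0 \<tau>) = sets (obs_space p)"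
      by (intro sets_pair_measure_cong) auto
    show "sets ?B = sets ?D"
      by (simp only: sB sets_density sD)
    fix A assume "A \<in> sets ?B"
    then have A [measurable]: "A \<in> sets (obs_space p)" using sB by simp
    have A' [measurable]: "A \<in> sets (gaussian_vec p \<Otimes>\<^sub>M gaussian 0 \<tau>)"
      using A by (simp only: sD)
    have "emeasure ?B A = (\<integral>\<^sup>+x. emeasure (gaussian (w x) \<tau> \<bind> (\<lambda>y. return (obs_space p) (x, y))) A \<partial>gaussian_vec p)"
      by (rule emeasure_bind_prob_algebra[OF gv K A])
    also have "\<dots> = (\<integral>\<^sup>+x. \<integral>\<^sup>+y. ennreal (exp ((w x * y - (w x)\<^sup>2 / 2) / \<tau>\<^sup>2)) * indicator A (x, y) \<partial>gaussian 0 \<tau> \<partial>gaussian_vec p)"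
    proof (intro nn_integral_cong)
      fix x assume "x \<in> space (gaussian_vec p)"
      then have x [measurable]: "x \<in> space (vec_space p)"
        using sets_eq_imp_space_eq[OF sets_gaussian_vec] by blast
      have "emeasure (gaussian (w x) \<tau> \<bind> (\<lambda>y. return (obs_space p) (x, y))) A =
          (\<integral>\<^sup>+y. emeasure (return (obs_space p) (x, y)) A \<partial>gaussian (w x) \<tau>)"
        using measurable_space[OF G x]
        by (intro emeasure_bind_prob_algebra[where N = borel and L = "obs_space p"]) auto
      also have "\<dots> = (\<integral>\<^sup>+y. indicator A (x, y) \<partial>gaussian (w x) \<tau>)"
        by (simp add: A)
      also have "\<dots> = (\<integral>\<^sup>+y. ennreal (exp ((w x * y - (w x)\<^sup>2 / 2) / \<tau>\<^sup>2)) * indicator A (x, y) \<partial>gaussian 0 \<tau>)"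
        unfolding gaussian_shift[OF \<tau>, of "w x"] by (rule nn_integral_density) measurable
      finally show "emeasure (gaussian (w x) \<tau> \<bind> (\<lambda>y. return (obs_space p) (x, y))) A =
        (\<integral>\<^sup>+y. ennreal (exp ((w x * y - (w x)\<^sup>2 / 2) / \<tau>\<^sup>2)) * indicator A (x, y) \<partial>gaussian 0 \<tau>)" .
    qed
    also have "\<dots> = emeasure ?D A"
      by (subst emeasure_density) (auto simp flip: G.nn_integral_fst)
    finally show "emeasure ?B A = emeasure ?D A" .
  qed
qed

definition reference_law :: "nat \<Rightarrow> real \<Rightarrow> real \<Rightarrow> ((nat \<Rightarrow> real) \<times> real) measure" where
  "reference_law p \<epsilon> \<sigma> = gaussian_vec p \<Otimes>\<^sub>M gaussian 0 (\<sigma> / sqrt (1 - \<epsilon> / 2))"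

lemma sets_reference_law [measurable_cong]: "sets (reference_law p \<epsilon> \<sigma>) = sets (obs_space p)"
  unfolding reference_law_def by (intro sets_pair_measure_cong) auto

lemma prob_space_reference_law: "\<epsilon> < 1 / 2 \<Longrightarrow> 0 < \<sigma> \<Longrightarrow> prob_space (reference_law p \<epsilon> \<sigma>)"
  unfolding reference_law_def by (intro prob_space_pair prob_space_gaussian_vec prob_space_gaussian) simp

lemma data_law_masking_le:
  assumes \<epsilon>: "0 \<le> \<epsilon>" "\<epsilon> < 1 / 2" and \<sigma>: "0 < \<sigma>"
    and \<theta>: "(\<Sum>j<p. (\<theta> j)\<^sup>2) \<le> R\<^sup>2" and l: "0 < l"
    and A: "A \<in> sets (data_space n p)" and K: "0 < K" and S: "0 < S"
  shows "emeasure (data_law n p \<epsilon> \<sigma> (\<lambda>j\<in>{..<p}. \<sigma> * \<theta> j) (masking p \<epsilon> \<sigma> \<theta>)) A \<le>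
    ennreal (n * (4 / l\<^sup>2 * exp (l\<^sup>2 * R\<^sup>2 / 2 - l * (\<epsilon> / 2))) / K) + ennreal (exp K / S) +
    ennreal S * emeasure (PiM {..<n} (\<lambda>_. reference_law p \<epsilon> \<sigma>)) A"
proof -
  define \<tau> where "\<tau> = \<sigma> / sqrt (1 - \<epsilon> / 2)"
  define w where "w = shrunk_mean p \<epsilon> \<sigma> \<theta>"
  define M where "M = reference_law p \<epsilon> \<sigma>"
  define L where "L = (\<lambda>z. exp ((w (fst z) * snd z - (w (fst z))\<^sup>2 / 2) / \<tau>\<^sup>2))"
  define v where "v = (\<lambda>z :: (nat \<Rightarrow> real) \<times> real. (soft (\<epsilon> / 2) (\<Sum>j<p. fst z j * \<theta> j))\<^sup>2)"
  define c where "c = 4 / l\<^sup>2 * exp (l\<^sup>2 * R\<^sup>2 / 2 - l * (\<epsilon> / 2))"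
  have \<tau>: "0 < \<tau>" using assms by (simp add: \<tau>_def)
  interpret G: prob_space "gaussian 0 \<tau>" by (rule prob_space_gaussian[OF \<tau>])
  have w [measurable]: "w \<in> borel_measurable (vec_space p)"
    unfolding w_def by measurable
  have M_eq: "M = gaussian_vec p \<Otimes>\<^sub>M gaussian 0 \<tau>"
    by (simp add: M_def reference_law_def \<tau>_def)
  have sM [measurable_cong]: "sets M = sets (obs_space p)"
    unfolding M_def by (rule sets_reference_law)
  have [measurable]: "L \<in> borel_measurable M" "v \<in> borel_measurable M"
    unfolding L_def v_def by measurable
  have law: "obs_law p \<epsilon> \<sigma> (\<lambda>j\<in>{..<p}. \<sigma> * \<theta> j) (masking p \<epsilon> \<sigma> \<theta>) = density M L"
    unfolding obs_law_def response_law_masking[OF \<epsilon> \<sigma>] M_eq L_def w_def[symmetric] \<tau>_def[symmetric]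
    by (rule gaussian_regression_density[OF \<tau> w])
  have "prob_space (density M L)"
    using obs_law_in_prob_algebra[OF masking_contaminations[OF \<epsilon> \<sigma>], where \<epsilon> = \<epsilon> and \<sigma> = \<sigma>] assms
    by (simp add: space_prob_algebra flip: law)
  moreover have "(\<integral>\<^sup>+z. ennreal ((L z)\<^sup>2 * exp (- v z)) \<partial>M) \<le> 1"
  proof -
    have "(L z)\<^sup>2 * exp (- v z) \<le> exp ((2 * w (fst z) * snd z - (2 * w (fst z))\<^sup>2 / 2) / \<tau>\<^sup>2)" for z
    proof -
      have "(w (fst z))\<^sup>2 / \<tau>\<^sup>2 = (1 - \<epsilon> / 2) * v z"
        using assms by (simp add: w_def shrunk_mean_def v_def \<tau>_def power_mult_distrib power_divide)
      also have "\<dots> \<le> v z"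
        using \<epsilon> by (intro mult_left_le_one_le) (auto simp: v_def)
      finally have "(w (fst z))\<^sup>2 / \<tau>\<^sup>2 \<le> v z" .
      moreover have "(L z)\<^sup>2 * exp (- v z) = exp (2 * ((w (fst z) * snd z - (w (fst z))\<^sup>2 / 2) / \<tau>\<^sup>2) - v z)"
        by (simp add: L_def exp_diff exp_minus field_simps flip: exp_double)
      moreover have "(2 * w (fst z) * snd z - (2 * w (fst z))\<^sup>2 / 2) / \<tau>\<^sup>2 =
          2 * ((w (fst z) * snd z - (w (fst z))\<^sup>2 / 2) / \<tau>\<^sup>2) - (w (fst z))\<^sup>2 / \<tau>\<^sup>2"
        using \<tau> by (simp add: field_simps power2_eq_square)
      ultimately show ?thesis by simp
    qed
    then have "(\<integral>\<^sup>+z. ennreal ((L z)\<^sup>2 * exp (- v z)) \<partial>M) \<le>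
        (\<integral>\<^sup>+z. ennreal (exp ((2 * w (fst z) * snd z - (2 * w (fst z))\<^sup>2 / 2) / \<tau>\<^sup>2)) \<partial>M)"
      by (intro nn_integral_mono ennreal_leI)
    also have "\<dots> = (\<integral>\<^sup>+x. \<integral>\<^sup>+y. ennreal (exp ((2 * w x * y - (2 * w x)\<^sup>2 / 2) / \<tau>\<^sup>2)) \<partial>gaussian 0 \<tau> \<partial>gaussian_vec p)"
      unfolding M_eq by (subst G.nn_integral_fst[symmetric]) auto
    also have "\<dots> = 1"
      unfolding nn_integral_gaussian_shift[OF \<tau>]
      by (simp add: prob_space.emeasure_space_1[OF prob_space_gaussian_vec])
    finally show ?thesis .
  qed
  moreover have "(\<integral>\<^sup>+z. ennreal (v z) \<partial>density M L) \<le> ennreal c"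
  proof -
    have "(\<integral>\<^sup>+z. ennreal (v z) \<partial>density M L) = (\<integral>\<^sup>+z. ennreal (L z) * ennreal (v z) \<partial>M)"
      by (intro nn_integral_density) measurable
    also have "\<dots> = (\<integral>\<^sup>+x. \<integral>\<^sup>+y. ennreal (L (x, y)) * ennreal (v (x, y)) \<partial>gaussian 0 \<tau> \<partial>gaussian_vec p)"
      unfolding M_eq L_def v_def by (subst G.nn_integral_fst[symmetric]) auto
    also have "\<dots> = (\<integral>\<^sup>+x. ennreal ((soft (\<epsilon> / 2) (\<Sum>j<p. x j * \<theta> j))\<^sup>2) \<partial>gaussian_vec p)"
      by (simp add: L_def v_def nn_integral_multc nn_integral_gaussian_shift[OF \<tau>])
    also have "\<dots> \<le> ennreal c"
      unfolding c_def by (rule gaussian_vec_soft_square_le[OF l \<theta>])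
    finally show ?thesis .
  qed
  moreover have "A \<in> sets (PiM {..<n} (\<lambda>_. M))"
    using A sets_PiM_cong[OF refl, of "{..<n}" "\<lambda>_. M" "\<lambda>_. obs_space p"] sM by simp
  moreover have "prob_space M"
    unfolding M_def using prob_space_reference_law assms by simp
  ultimately have "emeasure (PiM {..<n} (\<lambda>_. density M L)) A \<le>
    ennreal (card {..<n} * c / K) + ennreal (exp K / S) + ennreal S * emeasure (PiM {..<n} (\<lambda>_. M)) A"
    using K S by (intro emeasure_PiM_density_le[where v = v]) (auto simp: L_def v_def c_def)
  then show ?thesis
    by (simp add: data_law_def law c_def M_def)
qed

lemma rate_parameters:
  fixes n p :: nat and \<epsilon> :: real
  assumes n: "1 \<le> n" and p: "1 \<le> p" and \<epsilon>: "0 \<le> \<epsilon>"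
  obtains R l where "0 < R" "0 < l"
    "n * (4 / l\<^sup>2 * exp (l\<^sup>2 * R\<^sup>2 / 2 - l * (\<epsilon> / 2))) \<le> 8 * real p"
    "sqrt (real p / real n) + \<epsilon> / sqrt (ln (real n * \<epsilon>\<^sup>2 / real p + exp 1)) \<le> 9 * R"
proof -
  define s where "s = real n * \<epsilon>\<^sup>2 / real p"
  define q where "q = ln (s + exp 1)"
  have s0: "0 \<le> s" by (simp add: s_def)
  have pos: "0 < s + exp 1" using s0 by (simp add: add_nonneg_pos)
  have "ln (exp 1) \<le> q"
    unfolding q_def using s0 pos by (subst ln_le_cancel_iff) auto
  then have q1: "1 \<le> q" by simp
  then have sq1: "1 \<le> sqrt q" by simp
  show thesis
  proof (cases "s \<le> 1")
    case True
    define R where "R = sqrt (real p / real n)"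
    have R: "0 < R" "R\<^sup>2 = real p / real n"
      using n p by (auto simp: R_def)
    have "\<epsilon>\<^sup>2 \<le> R\<^sup>2"
      using True n p by (simp add: R s_def field_simps)
    then have "\<epsilon> \<le> R" by (rule power2_le_imp_le) (use R in simp)
    moreover have "\<epsilon> / sqrt q \<le> \<epsilon> / 1"
      using sq1 \<epsilon> by (intro divide_left_mono) auto
    ultimately have rate: "R + \<epsilon> / sqrt q \<le> 9 * R"
      using R by simp
    have "exp (1 / 2 - 1 / R * (\<epsilon> / 2)) \<le> exp (1 / 2 :: real)"
      using R \<epsilon> by simp
    also have "\<dots> \<le> 2"
      using exp_bound_half[of "1/2::real"] by simp
    finally have "4 / (1 / R)\<^sup>2 * exp ((1 / R)\<^sup>2 * R\<^sup>2 / 2 - 1 / R * (\<epsilon> / 2)) \<le> 4 / (1 / R)\<^sup>2 * 2"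
      using R by (intro mult_left_mono) (auto simp: power_divide)
    also have "\<dots> = 8 * real p / real n"
      using R by (simp add: power_divide)
    finally have "real n * (4 / (1 / R)\<^sup>2 * exp ((1 / R)\<^sup>2 * R\<^sup>2 / 2 - 1 / R * (\<epsilon> / 2))) \<le> 8 * real p"
      using n by (simp add: field_simps)
    with that[of R "1 / R"] R rate show thesis
      by (simp add: R_def q_def s_def)
  next
    case False
    have \<epsilon>0: "0 < \<epsilon>" using False \<epsilon> by (cases "\<epsilon> = 0") (auto simp: s_def)
    define \<delta> where "\<delta> = \<epsilon> / 2"
    have \<delta>: "0 < \<delta>" "\<epsilon> = 2 * \<delta>" using \<epsilon>0 by (auto simp: \<delta>_def)
    define R where "R = \<delta> / sqrt (2 * q)"
    have R: "0 < R" "R\<^sup>2 = \<delta>\<^sup>2 / (2 * q)"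
      using \<delta> q1 by (auto simp: R_def power_divide)
    define l where "l = 2 * q / \<delta>"
    have l: "0 < l" using q1 \<delta> by (simp add: l_def)
    have "l\<^sup>2 * R\<^sup>2 / 2 = q"
      unfolding R(2) l_def using q1 \<delta>(1) by (simp add: field_simps power2_eq_square)
    moreover have "l * \<delta> = 2 * q"
      using \<delta>(1) by (simp add: l_def)
    ultimately have e: "exp (l\<^sup>2 * R\<^sup>2 / 2 - l * (\<epsilon> / 2)) = 1 / (s + exp 1)"
      using pos by (simp add: \<delta> q_def exp_minus inverse_eq_divide)
    have "1 / (s + exp 1) \<le> 1 / s"
      using False by (intro divide_left_mono) (auto intro!: mult_pos_pos add_pos_pos)
    then have "n * (4 / l\<^sup>2 * exp (l\<^sup>2 * R\<^sup>2 / 2 - l * (\<epsilon> / 2))) \<le> n * (4 / l\<^sup>2 * (1 / s))"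
      unfolding e by (intro mult_left_mono) auto
    also have "\<dots> = (real n * \<delta>\<^sup>2 / s) / q\<^sup>2"
      by (simp add: l_def power_divide power_mult_distrib)
    also have "real n * \<delta>\<^sup>2 / s = real p / 4"
      using n p \<delta> by (simp add: s_def power_mult_distrib)
    also have "real p / 4 / q\<^sup>2 \<le> real p / 4 / 1"
      using q1 by (intro divide_left_mono) auto
    finally have info: "n * (4 / l\<^sup>2 * exp (l\<^sup>2 * R\<^sup>2 / 2 - l * (\<epsilon> / 2))) \<le> 8 * real p"
      by simp
    have "q \<le> s + exp 1 - 1"
      unfolding q_def using pos by (rule ln_le_minus_one)
    then have "q \<le> 4 * s"
      using exp_le False by linarith
    then have "sqrt q \<le> sqrt (4 * s)" by simp
    then have sq: "sqrt q \<le> 2 * sqrt s" by (simp add: real_sqrt_mult)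
    have "sqrt (real p / real n) = \<epsilon> / sqrt s"
      using n p \<epsilon>0 by (simp add: s_def real_sqrt_mult real_sqrt_divide)
    also have "\<dots> \<le> 2 * (\<epsilon> / sqrt q)"
      using sq \<epsilon>0 q1 False by (simp add: field_simps)
    finally have "sqrt (real p / real n) + \<epsilon> / sqrt q \<le> 3 * (\<epsilon> / sqrt q)" by simp
    also have "\<dots> = 3 * (2 * sqrt 2 * R)"
      using \<delta> q1 by (simp add: R_def real_sqrt_mult)
    also have "3 * (2 * sqrt 2 * R) \<le> 9 * R"
    proof -
      have "sqrt 2 \<le> 3 / 2"
        by (rule real_le_lsqrt) (auto simp: power2_eq_square)
      then show ?thesis using R(1) by simp
    qed
    finally show thesis
      using that[OF R(1) l info] by (simp add: q_def s_def)
  qed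
qed

lemma sets_estimator_ball:
  assumes b: "b \<in> estimators n p"
  shows "{\<omega> \<in> space (data_space n p). L2_set (\<lambda>j. b \<omega> j - \<beta> j) {..<p} < r} \<in> sets (data_space n p)"
proof -
  have b': "b \<in> data_space n p \<rightarrow>\<^sub>M vec_space p"
    using b by (simp add: estimators_def)
  have bj: "(\<lambda>\<omega>. b \<omega> j) \<in> borel_measurable (data_space n p)" if "j \<in> {..<p}" for j
    using measurable_compose[OF b' measurable_component_singleton[OF that]] .
  have "(\<lambda>\<omega>. L2_set (\<lambda>j. b \<omega> j - \<beta> j) {..<p}) \<in> borel_measurable (data_space n p)"
    unfolding L2_set_def
    by (intro measurable_compose[OF _ borel_measurable_sqrt] borel_measurable_sum borel_measurable_power
        borel_measurable_diff bj borel_measurable_const)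
  then show ?thesis
    by (rule borel_measurable_less[OF _ borel_measurable_const])
qed

lemma ennreal_half: "ennreal (1 / 2) = 1 / 2"
  using ennreal_divide_numeral[of 1 "num.Bit0 num.One"] by (simp only: ennreal_1)

lemma estimation_error_lower_bound:
  fixes m :: nat
  assumes m: "128 * exp 65 \<le> real m"
    and n: "1 \<le> n" and p: "1 \<le> p" and \<epsilon>: "0 \<le> \<epsilon>" "\<epsilon> < 1 / 2" and \<sigma>: "0 < \<sigma>"
    and R: "0 < R" and l: "0 < l"
    and info: "n * (4 / l\<^sup>2 * exp (l\<^sup>2 * R\<^sup>2 / 2 - l * (\<epsilon> / 2))) \<le> 8 * real p"
    and b: "b \<in> estimators n p"
  obtains \<beta> Q where "\<beta> \<in> space (vec_space p)" "Q \<in> contaminations p"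
    "emeasure (data_law n p \<epsilon> \<sigma> \<beta> Q)
       {\<omega> \<in> space (data_space n p). L2_set (\<lambda>j. b \<omega> j - \<beta> j) {..<p} < \<sigma> * R / (2 * real m * sqrt m)} \<le> 1 / 2"
proof (rule ccontr)
  assume "\<not> thesis"
  note neg = this
  define G where "G = PiE {..<p} (\<lambda>_. {..<m})"
  define a where "a = R / (real m * sqrt p)"
  define \<theta> where "\<theta> = (\<lambda>(k :: nat \<Rightarrow> nat) j. a * real (k j))"
  define \<beta> where "\<beta> = (\<lambda>k. \<lambda>j\<in>{..<p}. \<sigma> * \<theta> k j)"
  define r where "r = \<sigma> * R / (2 * real m * sqrt m)"
  define E where "E = (\<lambda>k. {\<omega> \<in> space (data_space n p). L2_set (\<lambda>j. b \<omega> j - \<beta> k j) {..<p} < r})"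
  define P0 where "P0 = PiM {..<n} (\<lambda>_. reference_law p \<epsilon> \<sigma>)"
  define K where "K = 64 * real p"
  define S where "S = 8 * exp K"
  have "0 < 128 * exp (65::real)" by simp
  then have m0: "0 < real m" using m by linarith
  have a: "0 < a" using R m0 p by (simp add: a_def)
  have KS: "0 < K" "0 < S" using p by (auto simp: K_def S_def)
  interpret P0: prob_space P0
    unfolding P0_def using \<epsilon> \<sigma> by (intro prob_space_PiM prob_space_reference_law)
  have sP0 [measurable_cong]: "sets P0 = sets (data_space n p)"
    unfolding P0_def by (intro sets_PiM_cong sets_reference_law refl)
  have E [measurable]: "E k \<in> sets (data_space n p)" for k
    unfolding E_def by (rule sets_estimator_ball[OF b])
  have fin: "finite G" unfolding G_def by (intro finite_PiE) auto
  have card_G: "card G = m ^ p" unfolding G_def by (simp add: card_PiE)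
  have \<theta>: "(\<Sum>j<p. (\<theta> k j)\<^sup>2) \<le> R\<^sup>2" if "k \<in> G" for k
  proof -
    have "(\<Sum>j<p. (\<theta> k j)\<^sup>2) \<le> (\<Sum>j<p. (a * real m)\<^sup>2)"
      using that a by (intro sum_mono power_mono) (auto simp: \<theta>_def G_def PiE_iff less_imp_le)
    also have "\<dots> = R\<^sup>2"
      using m0 p by (simp add: a_def power_divide power_mult_distrib)
    finally show ?thesis .
  qed
  have bound: "emeasure (data_law n p \<epsilon> \<sigma> (\<beta> k) (masking p \<epsilon> \<sigma> (\<theta> k))) (E k) \<le>
      ennreal (1 / 4) + ennreal S * emeasure P0 (E k)" if k: "k \<in> G" for k
  proof -
    have "emeasure (data_law n p \<epsilon> \<sigma> (\<beta> k) (masking p \<epsilon> \<sigma> (\<theta> k))) (E k) \<le>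
      ennreal (n * (4 / l\<^sup>2 * exp (l\<^sup>2 * R\<^sup>2 / 2 - l * (\<epsilon> / 2))) / K) + ennreal (exp K / S) + ennreal S * emeasure P0 (E k)"
      unfolding \<beta>_def P0_def by (rule data_law_masking_le[OF \<epsilon> \<sigma> \<theta>[OF k] l E KS])
    also have "\<dots> \<le> ennreal (1 / 8) + ennreal (1 / 8) + ennreal S * emeasure P0 (E k)"
    proof (intro add_mono ennreal_leI order_refl)
      show "n * (4 / l\<^sup>2 * exp (l\<^sup>2 * R\<^sup>2 / 2 - l * (\<epsilon> / 2))) / K \<le> 1 / 8"
        using divide_right_mono[OF info, of K] p by (simp add: K_def)
    qed (simp add: S_def)
    also have "ennreal (1 / 8) + ennreal (1 / 8) = ennreal (1 / 4)"
      by (simp flip: ennreal_plus)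
    finally show ?thesis .
  qed
  have "(\<Sum>k\<in>G. emeasure P0 (E k)) = (\<integral>\<^sup>+\<omega>. (\<Sum>k\<in>G. indicator (E k) \<omega>) \<partial>P0)"
    by (subst nn_integral_sum) auto
  also have "\<dots> \<le> (\<integral>\<^sup>+\<omega>. ennreal ((2 * exp 1) ^ p) \<partial>P0)"
  proof (intro nn_integral_mono)
    fix \<omega>
    define c where "c = (\<lambda>j. b \<omega> j / (\<sigma> * a))"
    have "4 * real m * (\<Sum>j<p. (c j - real (k j))\<^sup>2) < real p" if "\<omega> \<in> E k" for k
    proof -
      have "(\<Sum>j<p. (b \<omega> j - \<beta> k j)\<^sup>2) = (L2_set (\<lambda>j. b \<omega> j - \<beta> k j) {..<p})\<^sup>2"
        by (simp add: L2_set_def sum_nonneg)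
      also have "\<dots> < r\<^sup>2"
        using that by (intro power_strict_mono) (auto simp: E_def)
      also have "r\<^sup>2 = (\<sigma> * a)\<^sup>2 * (real p / (4 * real m))"
        using m0 p by (simp add: r_def a_def power_divide power_mult_distrib field_simps)
      also have "(\<Sum>j<p. (b \<omega> j - \<beta> k j)\<^sup>2) = (\<Sum>j<p. (\<sigma> * a)\<^sup>2 * (c j - real (k j))\<^sup>2)"
        using \<sigma> a by (intro sum.cong refl) (simp add: \<beta>_def \<theta>_def c_def field_simps flip: power_mult_distrib)
      also have "\<dots> = (\<sigma> * a)\<^sup>2 * (\<Sum>j<p. (c j - real (k j))\<^sup>2)"
        by (simp add: sum_distrib_left)
      finally have "(\<Sum>j<p. (c j - real (k j))\<^sup>2) < real p / (4 * real m)"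
        by (rule mult_left_less_imp_less) simp
      then show ?thesis
        using m0 by (simp add: field_simps)
    qed
    then have "{k \<in> G. \<omega> \<in> E k} \<subseteq> {k \<in> G. 4 * real m * (\<Sum>j<p. (c j - real (k j))\<^sup>2) < real p}"
      by auto
    then have "card {k \<in> G. \<omega> \<in> E k} \<le> card {k \<in> G. 4 * real m * (\<Sum>j<p. (c j - real (k j))\<^sup>2) < real p}"
      using fin by (intro card_mono) auto
    moreover have "real (card {k \<in> G. 4 * real m * (\<Sum>j<p. (c j - real (k j))\<^sup>2) < real p}) \<le> (2 * exp 1) ^ p"
      unfolding G_def using m0 by (intro card_grid_ball_le) simp
    ultimately have "real (card {k \<in> G. \<omega> \<in> E k}) \<le> (2 * exp 1) ^ p"
      by linarith
    moreover have "(\<Sum>k\<in>G. indicator (E k) \<omega>) = ennreal (real (card {k \<in> G. \<omega> \<in> E k}))"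
      using fin by (simp add: indicator_def sum.If_cases Int_def ennreal_of_nat_eq_real_of_nat)
    ultimately show "(\<Sum>k\<in>G. indicator (E k) \<omega>) \<le> ennreal ((2 * exp 1) ^ p)"
      by (simp add: ennreal_leI)
  qed
  also have "\<dots> = ennreal ((2 * exp 1) ^ p)"
    by (simp add: P0.emeasure_space_1)
  finally have sum_P0: "(\<Sum>k\<in>G. emeasure P0 (E k)) \<le> ennreal ((2 * exp 1) ^ p)" .
  have "S * (2 * exp 1) ^ p = 8 * (2 * exp 65) ^ p"
    by (simp add: S_def K_def power_mult_distrib mult_exp_exp flip: exp_of_nat_mult)
  also have "\<dots> \<le> 8 * (real m / 64) ^ p"
    using m by (intro mult_left_mono power_mono) auto
  also have "\<dots> = 8 * (real m ^ p / 64 ^ p)"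
    by (simp add: power_divide)
  also have "\<dots> \<le> 8 * (real m ^ p / 64 ^ 1)"
    using p m0 by (intro mult_left_mono divide_left_mono power_increasing) auto
  finally have small: "S * (2 * exp 1) ^ p \<le> real m ^ p / 8" by simp
  have const: "(\<Sum>k\<in>G. ennreal x) = ennreal (real m ^ p * x)" if "0 \<le> x" for x
    using that by (simp add: card_G ennreal_of_nat_eq_real_of_nat ennreal_mult)
  have "ennreal (real m ^ p / 2) = (\<Sum>k\<in>G. ennreal (1 / 2))"
    by (subst const) auto
  also have "\<dots> \<le> (\<Sum>k\<in>G. emeasure (data_law n p \<epsilon> \<sigma> (\<beta> k) (masking p \<epsilon> \<sigma> (\<theta> k))) (E k))"
  proof (rule sum_mono)
    fix k
    have "\<beta> k \<in> space (vec_space p)"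
      by (auto simp: \<beta>_def space_PiM)
    with neg that[OF this masking_contaminations[OF \<epsilon> \<sigma>], of "\<theta> k"]
    have "\<not> emeasure (data_law n p \<epsilon> \<sigma> (\<beta> k) (masking p \<epsilon> \<sigma> (\<theta> k))) (E k) \<le> 1 / 2"
      by (auto simp: E_def r_def)
    then show "ennreal (1 / 2) \<le> emeasure (data_law n p \<epsilon> \<sigma> (\<beta> k) (masking p \<epsilon> \<sigma> (\<theta> k))) (E k)"
      by (simp only: ennreal_half not_le less_imp_le)
  qed
  also have "\<dots> \<le> (\<Sum>k\<in>G. ennreal (1 / 4) + ennreal S * emeasure P0 (E k))"
    by (intro sum_mono bound)
  also have "\<dots> = ennreal (real m ^ p / 4) + ennreal S * (\<Sum>k\<in>G. emeasure P0 (E k))"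
    unfolding sum.distrib by (subst const) (auto simp: sum_distrib_left)
  also have "\<dots> \<le> ennreal (real m ^ p / 4) + ennreal S * ennreal ((2 * exp 1) ^ p)"
    by (intro add_left_mono mult_left_mono sum_P0) auto
  also have "\<dots> = ennreal (real m ^ p / 4 + S * (2 * exp 1) ^ p)"
    using KS by (simp flip: ennreal_mult ennreal_plus)
  finally have "real m ^ p / 2 \<le> real m ^ p / 4 + S * (2 * exp 1) ^ p"
    using KS by (subst (asm) ennreal_le_iff) (auto intro!: add_nonneg_nonneg)
  with small have "real m ^ p \<le> 0" by simp
  moreover have "0 < real m ^ p" using m0 by simp
  ultimately show False by linarith
qed

theorem theorem3p6:
  shows "\<exists>C>0. \<forall>(n::nat) (p::nat) (\<epsilon>::real) (\<sigma>::real).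
    1 \<le> n \<longrightarrow> 1 \<le> p \<longrightarrow> 0 \<le> \<epsilon> \<longrightarrow> \<epsilon> < 1 / 2 \<longrightarrow> 0 < \<sigma> \<longrightarrow>
    (INF b \<in> estimators n p. SUP (\<beta>, Q) \<in> space (vec_space p) \<times> contaminations p.
       emeasure (data_law n p \<epsilon> \<sigma> \<beta> Q)
         {\<omega> \<in> space (data_law n p \<epsilon> \<sigma> \<beta> Q).
            L2_set (\<lambda>j. b \<omega> j - \<beta> j) {..<p} \<ge>
              C * \<sigma> * (sqrt (real p / real n) + \<epsilon> / sqrt (ln (real n * \<epsilon>\<^sup>2 / real p + exp 1)))})
    \<ge> 1 / 2"
proof -
  obtain m :: nat where m: "128 * exp 65 \<le> real m"
    using real_arch_simple by blast
  have "0 < 128 * exp (65::real)" by simp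
  then have m0: "0 < real m" using m by linarith
  define C where "C = 1 / (18 * real m * sqrt m)"
  have C: "0 < C" using m0 by (simp add: C_def)
  show ?thesis
  proof (intro exI[of _ C] conjI C allI impI)
    fix n p :: nat and \<epsilon> \<sigma> :: real
    assume n: "1 \<le> n" and p: "1 \<le> p" and \<epsilon>: "0 \<le> \<epsilon>" "\<epsilon> < 1 / 2" and \<sigma>: "0 < \<sigma>"
    define rate where "rate = sqrt (real p / real n) + \<epsilon> / sqrt (ln (real n * \<epsilon>\<^sup>2 / real p + exp 1))"
    obtain R l where Rl: "0 < R" "0 < l"
      "n * (4 / l\<^sup>2 * exp (l\<^sup>2 * R\<^sup>2 / 2 - l * (\<epsilon> / 2))) \<le> 8 * real p" and rate: "rate \<le> 9 * R"
      unfolding rate_def using rate_parameters[OF n p \<epsilon>(1)] .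
    have "C * \<sigma> * rate \<le> C * \<sigma> * (9 * R)"
      using C \<sigma> rate by (intro mult_left_mono) auto
    also have "\<dots> = \<sigma> * R / (2 * real m * sqrt m)"
      by (simp add: C_def mult_ac)
    finally have radius: "C * \<sigma> * rate \<le> \<sigma> * R / (2 * real m * sqrt m)" .
    have sup: "1 / 2 \<le> (SUP (\<beta>, Q) \<in> space (vec_space p) \<times> contaminations p. emeasure (data_law n p \<epsilon> \<sigma> \<beta> Q)
         {\<omega> \<in> space (data_law n p \<epsilon> \<sigma> \<beta> Q). L2_set (\<lambda>j. b \<omega> j - \<beta> j) {..<p} \<ge> C * \<sigma> * rate})"
      if b: "b \<in> estimators n p" for b
    proof -
      obtain \<beta> Q where \<beta>: "\<beta> \<in> space (vec_space p)" and Q: "Q \<in> contaminations p" and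
        half: "emeasure (data_law n p \<epsilon> \<sigma> \<beta> Q) {\<omega> \<in> space (data_space n p).
          L2_set (\<lambda>j. b \<omega> j - \<beta> j) {..<p} < \<sigma> * R / (2 * real m * sqrt m)} \<le> 1 / 2"
        using estimation_error_lower_bound[OF m n p \<epsilon> \<sigma> Rl b] .
      define D where "D = data_law n p \<epsilon> \<sigma> \<beta> Q"
      define B where "B = {\<omega> \<in> space (data_space n p). L2_set (\<lambda>j. b \<omega> j - \<beta> j) {..<p} < C * \<sigma> * rate}"
      interpret D: prob_space D
        unfolding D_def using prob_space_data_law[OF Q _ _ \<sigma>] \<epsilon> by simp
      have sD: "sets D = sets (data_space n p)"
        unfolding D_def using sets_data_law[OF Q _ _ \<sigma>] \<epsilon> by simp
      have spD: "space D = space (data_space n p)"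
        using sets_eq_imp_space_eq[OF sD] .
      have B: "B \<in> sets D"
        unfolding sD B_def by (rule sets_estimator_ball[OF b])
      have "emeasure D B \<le> emeasure D {\<omega> \<in> space (data_space n p).
          L2_set (\<lambda>j. b \<omega> j - \<beta> j) {..<p} < \<sigma> * R / (2 * real m * sqrt m)}"
        using radius sets_estimator_ball[OF b] sD
        by (intro emeasure_mono) (auto simp: B_def)
      also have "\<dots> \<le> 1 / 2" using half by (simp add: D_def)
      finally have "emeasure D B \<le> ennreal (1 / 2)"
        by (simp only: ennreal_half)
      then have "D.prob B \<le> 1 / 2"
        unfolding D.emeasure_eq_measure by (subst (asm) ennreal_le_iff) auto
      then have "1 / 2 \<le> D.prob (space D - B)"
        using D.prob_compl[OF B] by simp
      then have "ennreal (1 / 2) \<le> emeasure D (space D - B)"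
        unfolding D.emeasure_eq_measure by (rule ennreal_leI)
      also have "space D - B = {\<omega> \<in> space D. L2_set (\<lambda>j. b \<omega> j - \<beta> j) {..<p} \<ge> C * \<sigma> * rate}"
        by (auto simp: B_def spD)
      finally show ?thesis
        using \<beta> Q unfolding ennreal_half D_def by (intro SUP_upper2[of "(\<beta>, Q)"]) auto
    qed
    show "1 / 2 \<le> (INF b \<in> estimators n p. SUP (\<beta>, Q) \<in> space (vec_space p) \<times> contaminations p.
       emeasure (data_law n p \<epsilon> \<sigma> \<beta> Q)
         {\<omega> \<in> space (data_law n p \<epsilon> \<sigma> \<beta> Q).
            L2_set (\<lambda>j. b \<omega> j - \<beta> j) {..<p} \<ge>
              C * \<sigma> * (sqrt (real p / real n) + \<epsilon> / sqrt (ln (real n * \<epsilon>\<^sup>2 / real p + exp 1)))})"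
      unfolding rate_def[symmetric] by (rule INF_greatest[OF sup])
  qed
qed

end
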